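(* Let $\mathcal X=\{A_1,\dots,A_N\}$ be a collection of real matrices in $\mathbb{R}^{d_1\times d_2}$ with $\|A_i\|\le\sigma$ for all $i$, for some $\sigma>0$, and let $\mu=\frac1N\sum_{i=1}^NA_i$. Let $1\le n<N$ and let $X_1,\dots,X_n$ be drawn from $\mathcal X$ by sampling without replacement. Then for every $\epsilon>0$, $$P\Big(\Big\|\frac1n\sum_{i=1}^nX_i-\mu\Big\|\ge\epsilon\Big)\le2(d_1+d_2)\exp\Big(-\frac{n\epsilon^2}{8\sigma^2(1+1/n)(1-n/N)}\Big).$$
   Context: $\|\cdot\|$ is the spectral norm. Sampling without replacement: $(X_1,\dots,X_n)=(A_{\pi(1)},\dots,A_{\pi(n)})$ where $\pi$ is a uniformly random permutation of $\{1,\dots,N\}$. *)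

theory Defs
  imports "HOL-Analysis.Analysis" "HOL-Probability.Probability"
begin

definition spectral_norm :: "real^'d2^'d1 \<Rightarrow> real" where
  "spectral_norm M = onorm (\<lambda>x. M *v x)"

definition unif_perm :: "nat \<Rightarrow> (nat \<Rightarrow> nat) pmf" where
  "unif_perm N = pmf_of_set {\<pi>. \<pi> permutes {..<N}}"

end

theory Submission
  imports Defs
begin

text \<open>
  The running mean \<open>M\<^sub>j\<close> of the first \<open>j\<close> samples, followed from \<open>j = N\<close> down to \<open>j = n\<close>, is a
  reverse martingale started at \<open>\<mu>\<close>: \<open>M\<^sub>j - M\<^sub>j\<^sub>+\<^sub>1 = (M\<^sub>j\<^sub>+\<^sub>1 - X\<^sub>j\<^sub>+\<^sub>1) / j\<close>, where
  \<open>X\<^sub>j\<^sub>+\<^sub>1\<close> is uniform among the first \<open>j + 1\<close> samples. Its increments have norm at most \<open>2\<sigma>/j\<close>, and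
  \<open>\<Sum>\<^sub>n\<^sub>\<le>\<^sub>j\<^sub><\<^sub>N 1/j\<^sup>2 \<le> (1 + 1/n)(1/n - 1/N)\<close> by telescoping.

  After passing to symmetric matrices by the Hermitian dilation, Gaussian bounds on the even trace
  moments \<open>tr H\<^sup>2\<^sup>p\<close> are propagated through the martingale by induction on \<open>p\<close>. Along \<open>S + tX\<close> the
  first derivative of the \<open>2p\<close>-th moment averages to zero at \<open>t = 0\<close>, and the second one is a sum of
  terms \<open>tr (X H\<^sup>a X H\<^sup>b)\<close>, each at most \<open>\<parallel>X\<parallel>\<^sup>2 tr H\<^sup>a\<^sup>+\<^sup>b\<close>. No matrix exponential, and hence
  no trace inequality of Golden--Thompson or Lieb type, is needed.
\<close>

section \<open>Spectral and Frobenius norm\<close>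

lemma norm_matrix_vector_mult_le_spectral_norm: "norm (A *v x) \<le> spectral_norm A * norm x"
  unfolding spectral_norm_def by (intro onorm matrix_vector_mul_bounded_linear)

lemma spectral_norm_le: "(\<And>x. norm (A *v x) \<le> b * norm x) \<Longrightarrow> spectral_norm A \<le> b"
  unfolding spectral_norm_def by (rule onorm_le)

lemma spectral_norm_nonneg: "0 \<le> spectral_norm A"
  unfolding spectral_norm_def by (intro onorm_pos_le matrix_vector_mul_bounded_linear)

lemma spectral_norm_mat_1: "spectral_norm (mat 1 :: real^'n^'n) = 1"
proof -
  have "(*v) (mat 1) = (\<lambda>x :: real^'n. x)"
    by (rule ext) simp
  then show ?thesis
    unfolding spectral_norm_def by (simp only: onorm_id)
qed

lemma spectral_norm_scaleR: "spectral_norm (r *\<^sub>R A) = \<bar>r\<bar> * spectral_norm A"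
  unfolding spectral_norm_def scaleR_matrix_vector_assoc[symmetric]
  by (intro onorm_scaleR matrix_vector_mul_bounded_linear)

lemma spectral_norm_diff_le: "spectral_norm (A - B) \<le> spectral_norm A + spectral_norm B"
proof (rule spectral_norm_le)
  fix x
  have "norm ((A - B) *v x) \<le> norm (A *v x) + norm (B *v x)"
    by (simp add: matrix_vector_mult_diff_rdistrib norm_triangle_ineq4)
  also have "\<dots> \<le> spectral_norm A * norm x + spectral_norm B * norm x"
    by (intro add_mono norm_matrix_vector_mult_le_spectral_norm)
  finally show "norm ((A - B) *v x) \<le> (spectral_norm A + spectral_norm B) * norm x"
    by (simp add: distrib_right)
qed

lemma matrix_vector_mult_sum_left: "(\<Sum>i\<in>I. A i) *v x = (\<Sum>i\<in>I. A i *v x)"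
  for A :: "'i \<Rightarrow> 'a::semiring_1^'n^'m"
  by (induction I rule: infinite_finite_induct) (simp_all add: matrix_vector_mult_add_rdistrib)

lemma spectral_norm_sum_le: "spectral_norm (\<Sum>i\<in>I. A i) \<le> (\<Sum>i\<in>I. spectral_norm (A i))"
proof (rule spectral_norm_le)
  fix x
  show "norm ((\<Sum>i\<in>I. A i) *v x) \<le> (\<Sum>i\<in>I. spectral_norm (A i)) * norm x"
    unfolding matrix_vector_mult_sum_left sum_distrib_right
    by (intro sum_norm_le norm_matrix_vector_mult_le_spectral_norm)
qed

lemma spectral_norm_mult_le: "spectral_norm (A ** B) \<le> spectral_norm A * spectral_norm B"
proof (rule spectral_norm_le)
  fix x
  have "norm ((A ** B) *v x) \<le> spectral_norm A * norm (B *v x)"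
    unfolding matrix_vector_mul_assoc[symmetric] by (rule norm_matrix_vector_mult_le_spectral_norm)
  also have "\<dots> \<le> spectral_norm A * (spectral_norm B * norm x)"
    by (intro mult_left_mono norm_matrix_vector_mult_le_spectral_norm spectral_norm_nonneg)
  finally show "norm ((A ** B) *v x) \<le> spectral_norm A * spectral_norm B * norm x"
    by (simp add: mult.assoc)
qed

lemma spectral_norm_transpose: "spectral_norm (transpose A) = spectral_norm A"
  for A :: "real^'n^'m"
proof -
  have "spectral_norm (transpose B) \<le> spectral_norm B" for B :: "real^'k^'l"
  proof (rule spectral_norm_le)
    fix y
    let ?z = "transpose B *v y"
    have "norm ?z * norm ?z = y \<bullet> (B *v ?z)"
      by (simp add: dot_lmul_matrix[symmetric] power2_norm_eq_inner[symmetric] power2_eq_square)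
    also have "\<dots> \<le> norm y * norm (B *v ?z)"
      by (rule norm_cauchy_schwarz)
    also have "\<dots> \<le> norm y * (spectral_norm B * norm ?z)"
      by (intro mult_left_mono norm_matrix_vector_mult_le_spectral_norm norm_ge_zero)
    finally show "norm ?z \<le> spectral_norm B * norm y"
      by (cases "?z = 0") (simp_all add: mult_ac spectral_norm_nonneg)
  qed
  from this[of A] this[of "transpose A"] show ?thesis by simp
qed

lemma power2_spectral_norm_le: "(spectral_norm A)\<^sup>2 \<le> spectral_norm (transpose A ** A)"
proof -
  have "spectral_norm A \<le> sqrt (spectral_norm (transpose A ** A))"
  proof (rule spectral_norm_le)
    fix x
    have "(norm (A *v x))\<^sup>2 = x \<bullet> ((transpose A ** A) *v x)"
      by (simp add: power2_norm_eq_inner dot_lmul_matrix[symmetric] inner_commute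
          flip: matrix_vector_mul_assoc)
    also have "\<dots> \<le> norm x * (spectral_norm (transpose A ** A) * norm x)"
      by (intro order_trans[OF norm_cauchy_schwarz] mult_left_mono
          norm_matrix_vector_mult_le_spectral_norm norm_ge_zero)
    finally have "(norm (A *v x))\<^sup>2 \<le> (sqrt (spectral_norm (transpose A ** A)) * norm x)\<^sup>2"
      by (simp add: power_mult_distrib spectral_norm_nonneg power2_eq_square mult_ac)
    then show "norm (A *v x) \<le> sqrt (spectral_norm (transpose A ** A)) * norm x"
      by (rule power2_le_imp_le) (simp add: spectral_norm_nonneg)
  qed
  from power_mono[OF this spectral_norm_nonneg, of 2] show ?thesis
    by (simp add: spectral_norm_nonneg)
qed

lemma spectral_norm_le_norm: "spectral_norm A \<le> norm A"
proof (rule spectral_norm_le)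
  fix x
  have "norm (A *v x) = L2_set (\<lambda>i. \<bar>A $ i \<bullet> x\<bar>) UNIV"
    by (simp add: norm_vec_def matrix_vector_mul_component)
  also have "\<dots> \<le> L2_set (\<lambda>i. norm (A $ i) * norm x) UNIV"
    by (intro L2_set_mono Cauchy_Schwarz_ineq2 abs_ge_zero)
  also have "\<dots> = norm A * norm x"
    by (simp add: norm_vec_def[of A] L2_set_left_distrib)
  finally show "norm (A *v x) \<le> norm A * norm x" .
qed

lemma transpose_add: "transpose (A + B) = transpose A + transpose B"
  by (simp add: transpose_def vec_eq_iff)

lemma linear_transpose: "linear (transpose :: real^'n^'m \<Rightarrow> real^'m^'n)"
  by (rule linearI) (simp_all add: transpose_add transpose_scalar)

lemma trace_transpose_mult: "trace (transpose A ** B) = (A :: real^'n^'m) \<bullet> B"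
  unfolding trace_def inner_vec_def transpose_def matrix_matrix_mult_def
  by simp (rule sum.swap)

lemma norm_transpose: "norm (transpose A) = norm (A :: real^'n^'m)"
proof -
  have "transpose A \<bullet> transpose A = trace (transpose (transpose A) ** transpose A)"
    by (rule trace_transpose_mult[symmetric])
  also have "\<dots> = trace (transpose A ** A)"
    unfolding transpose_transpose by (rule trace_mul_sym)
  also have "\<dots> = A \<bullet> A"
    by (rule trace_transpose_mult)
  finally show ?thesis by (simp add: norm_eq_sqrt_inner)
qed

lemma norm_matrix_mult_le_right: "norm (A ** B) \<le> norm A * spectral_norm B"
  for A :: "real^'n^'m" and B :: "real^'k^'n"
proof -
  have row: "(A ** B) $ i = transpose B *v (A $ i)" for i
    by (simp add: vec_eq_iff matrix_matrix_mult_def vector_matrix_mult_def mult.commute)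
  have "norm (A ** B) = L2_set (\<lambda>i. norm (transpose B *v (A $ i))) UNIV"
    by (simp only: norm_vec_def[of "A ** B"] row)
  also have "\<dots> \<le> L2_set (\<lambda>i. norm (A $ i) * spectral_norm B) UNIV"
    using norm_matrix_vector_mult_le_spectral_norm[of "transpose B"]
    by (intro L2_set_mono) (simp_all only: spectral_norm_transpose mult.commute norm_ge_zero)
  also have "\<dots> = norm A * spectral_norm B"
    by (simp add: norm_vec_def[of A] L2_set_left_distrib spectral_norm_nonneg)
  finally show ?thesis .
qed

lemma norm_matrix_mult_le_left: "norm (A ** B) \<le> spectral_norm A * norm B"
  using norm_matrix_mult_le_right[of "transpose B" "transpose A"]
  by (simp add: norm_transpose spectral_norm_transpose mult.commute flip: matrix_transpose_mul)

section \<open>Powers of symmetric matrices\<close>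

primrec matpow :: "'a::semiring_1^'n^'n \<Rightarrow> nat \<Rightarrow> 'a^'n^'n" where
  "matpow H 0 = mat 1"
| "matpow H (Suc k) = H ** matpow H k"

lemma matpow_add: "matpow H (j + k) = matpow H j ** matpow H k"
  by (induction j) (simp_all add: matrix_mul_assoc)

lemma matpow_commute: "H ** matpow H k = matpow H k ** H"
  using matpow_add[of H k 1] matpow_add[of H 1 k] by (simp add: add.commute)

lemma transpose_matpow: "transpose (matpow H k) = matpow (transpose H) k"
  for H :: "'a::comm_semiring_1^'n^'n"
  by (induction k) (simp_all add: matrix_transpose_mul matpow_commute)

lemma trace_matpow_even:
  fixes H :: "real^'n^'n"
  assumes "transpose H = H"
  shows "trace (matpow H (2 * p)) = (norm (matpow H p))\<^sup>2"
  using trace_transpose_mult[of "matpow H p" "matpow H p"] assms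
  by (simp add: transpose_matpow matpow_add[symmetric] power2_norm_eq_inner mult_2)

lemma spectral_norm_power_le_matpow:
  fixes H :: "real^'n^'n"
  assumes H_sym: "transpose H = H"
  shows "spectral_norm H ^ p \<le> spectral_norm (matpow H p)"
proof (induction p rule: less_induct)
  case (less p)
  have double: "spectral_norm H ^ (2 * q) \<le> spectral_norm (matpow H (2 * q))"
    if "q < p" for q
  proof -
    have "spectral_norm H ^ (2 * q) \<le> (spectral_norm (matpow H q))\<^sup>2"
      using power_mono[OF less[OF that], of 2] by (simp add: spectral_norm_nonneg power_even_eq)
    also have "\<dots> \<le> spectral_norm (matpow H (2 * q))"
      using power2_spectral_norm_le[of "matpow H q"]
      by (simp add: transpose_matpow H_sym mult_2 matpow_add)
    finally show ?thesis .
  qed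
  consider (zero) "p = 0" | (one) "p = 1" | (even) q where "0 < q" "p = 2 * q"
    | (odd) q where "0 < q" "p = 2 * q + 1"
    by (metis One_nat_def add.commute evenE mult_0_right neq0_conv oddE plus_1_eq_Suc)
  then show ?case
  proof cases
    case odd
    have "spectral_norm H * spectral_norm H ^ p \<le> spectral_norm (matpow H (Suc p))"
      using double[of "q + 1"] odd by simp
    also have "\<dots> \<le> spectral_norm H * spectral_norm (matpow H p)"
      by (simp add: spectral_norm_mult_le)
    finally show ?thesis
      using odd spectral_norm_nonneg[of H] spectral_norm_nonneg[of "matpow H p"]
      by (cases "spectral_norm H = 0") simp_all
  qed (use double in \<open>simp_all add: spectral_norm_mat_1\<close>)
qed

lemma spectral_norm_power_le_trace_matpow:
  fixes H :: "real^'n^'n"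
  assumes "transpose H = H"
  shows "spectral_norm H ^ (2 * p) \<le> trace (matpow H (2 * p))"
proof -
  have "spectral_norm H ^ p \<le> norm (matpow H p)"
    using spectral_norm_power_le_matpow[OF assms] spectral_norm_le_norm by (rule order_trans)
  from power_mono[OF this, of 2] show ?thesis
    by (simp add: trace_matpow_even[OF assms] power_even_eq spectral_norm_nonneg)
qed

lemma midpoint_convex_le_max_endpoints:
  fixes f :: "nat \<Rightarrow> 'a::linordered_idom"
  assumes "\<And>i. Suc i < q \<Longrightarrow> 2 * f (Suc i) \<le> f i + f (Suc (Suc i))" and "r \<le> q"
  shows "f r \<le> max (f 0) (f q)"
  using assms
proof (induction q arbitrary: r)
  case (Suc q)
  have interior: "f s \<le> max (f 0) (f q)" if "s \<le> q" for s
    using Suc.IH[OF Suc.prems(1)] that by simp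
  have "f q \<le> max (f 0) (f (Suc q))"
  proof (cases q)
    case (Suc m)
    have "f m \<le> max (f 0) (f q)" "2 * f q \<le> f m + f (Suc q)"
      using interior[of m] Suc.prems(1)[of m] Suc by auto
    then show ?thesis by (auto simp: max_def split: if_splits)
  qed simp
  with interior Suc.prems(2) show ?case
    by (cases "r = Suc q") (auto simp: le_Suc_eq le_max_iff_disj intro: order_trans)
qed simp

lemma twice_inner_le_sum_power2_norm: "2 * (x \<bullet> y) \<le> (norm x)\<^sup>2 + (norm y)\<^sup>2"
  for x y :: "'a::real_inner"
  using inner_ge_zero[of "x - y"] by (simp add: power2_norm_eq_inner inner_diff inner_commute)

definition matpow_sandwich :: "real^'n^'n \<Rightarrow> real^'n^'n \<Rightarrow> nat \<Rightarrow> nat \<Rightarrow> real^'n^'n" where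
  "matpow_sandwich H X q r = matpow H r ** X ** matpow H (q - r)"

lemma inner_matpow_sandwich:
  assumes H_sym: "transpose H = H" and "r \<le> q" and "s \<le> q"
  shows "matpow_sandwich H X q r \<bullet> matpow_sandwich H X q s
    = trace (transpose X ** matpow H (r + s) ** X ** matpow H (2 * q - (r + s)))"
proof -
  have "matpow_sandwich H X q r \<bullet> matpow_sandwich H X q s
      = trace (matpow H (q - r) ** (transpose X ** matpow H (r + s) ** X ** matpow H (q - s)))"
    unfolding trace_transpose_mult[symmetric] matpow_sandwich_def
    by (simp add: matrix_transpose_mul transpose_matpow H_sym matrix_mul_assoc matpow_add)
  also have "\<dots> = trace (transpose X ** matpow H (r + s) ** X ** matpow H ((q - s) + (q - r)))"
    unfolding matpow_add by (subst trace_mul_sym) (simp add: matrix_mul_assoc matpow_add)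
  also have "(q - s) + (q - r) = 2 * q - (r + s)"
    using assms by simp
  finally show ?thesis .
qed

text \<open>The squared norms are convex in \<open>r\<close>, hence maximal at an end point.\<close>

lemma norm_matpow_sandwich_le:
  assumes H_sym: "transpose H = H" and "r \<le> q"
  shows "(norm (matpow_sandwich H X q r))\<^sup>2 \<le> (spectral_norm X * norm (matpow H q))\<^sup>2"
proof -
  define W where "W = matpow_sandwich H X q"
  have "2 * (norm (W (Suc i)))\<^sup>2 \<le> (norm (W i))\<^sup>2 + (norm (W (Suc (Suc i))))\<^sup>2"
    if "Suc i < q" for i
  proof -
    have "(norm (W (Suc i)))\<^sup>2 = W i \<bullet> W (Suc (Suc i))"
      using that by (simp add: power2_norm_eq_inner W_def inner_matpow_sandwich H_sym)
    then show ?thesis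
      using twice_inner_le_sum_power2_norm by simp
  qed
  then have "(norm (W r))\<^sup>2 \<le> max ((norm (W 0))\<^sup>2) ((norm (W q))\<^sup>2)"
    by (rule midpoint_convex_le_max_endpoints[OF _ \<open>r \<le> q\<close>])
  moreover have "norm (W 0) \<le> spectral_norm X * norm (matpow H q)"
    using norm_matrix_mult_le_left[of X "matpow H q"] by (simp add: W_def matpow_sandwich_def)
  moreover have "norm (W q) \<le> spectral_norm X * norm (matpow H q)"
    using norm_matrix_mult_le_right[of "matpow H q" X]
    by (simp add: W_def matpow_sandwich_def mult.commute)
  ultimately show ?thesis
    unfolding W_def by (meson max.bounded_iff norm_ge_zero order_trans power_mono)
qed

lemma trace_matpow_sandwich_le:
  fixes H X :: "real^'n^'n"
  assumes H_sym: "transpose H = H" and exponents: "a + b = 2 * q"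
  shows "trace (transpose X ** matpow H a ** X ** matpow H b)
    \<le> (spectral_norm X)\<^sup>2 * trace (matpow H (2 * q))"
proof -
  obtain r s where rs: "r \<le> q" "s \<le> q" "a = r + s"
    using exponents by (intro that[of "min a q" "a - min a q"]) auto
  let ?W = "matpow_sandwich H X q"
  have "trace (transpose X ** matpow H a ** X ** matpow H b) = ?W r \<bullet> ?W s"
    using exponents rs by (simp add: inner_matpow_sandwich[OF H_sym] flip: exponents)
  also have "\<dots> \<le> (spectral_norm X * norm (matpow H q))\<^sup>2"
    using twice_inner_le_sum_power2_norm[of "?W r" "?W s"]
      norm_matpow_sandwich_le[OF H_sym rs(1), of X] norm_matpow_sandwich_le[OF H_sym rs(2), of X]
    by simp
  finally show ?thesis
    by (simp add: trace_matpow_even H_sym power_mult_distrib)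
qed

section \<open>Derivatives of traces of powers\<close>

lemma bounded_bilinear_matrix_matrix_mult:
  "bounded_bilinear ((**) :: real^'n^'m \<Rightarrow> real^'k^'n \<Rightarrow> real^'k^'m)"
  unfolding bilinear_conv_bounded_bilinear[symmetric] bilinear_def
  by (auto intro!: linearI simp: vec_eq_iff matrix_matrix_mult_def algebra_simps
      sum.distrib sum_distrib_left)

lemma bounded_linear_trace: "bounded_linear (trace :: real^'n^'n \<Rightarrow> real)"
  unfolding linear_conv_bounded_linear[symmetric]
  by (rule linearI) (auto simp: trace_def sum.distrib sum_distrib_left)

lemma bounded_linear_trace_mult_left: "bounded_linear (\<lambda>Z. trace (Y ** Z))"
  for Y :: "real^'n^'n"
  by (rule bounded_linear_compose[OF bounded_linear_trace
        bounded_bilinear.bounded_linear_right[OF bounded_bilinear_matrix_matrix_mult]])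

lemma bounded_linear_trace_mult_right: "bounded_linear (\<lambda>Z. trace (Z ** Y))"
  for Y :: "real^'n^'n"
  using bounded_linear_trace_mult_left[of Y] by (simp only: trace_mul_sym[of Y])

lemma has_vector_derivative_matpow:
  fixes H :: "real \<Rightarrow> real^'n^'n"
  assumes H: "(H has_vector_derivative X) (at t within T)"
  shows "((\<lambda>t. matpow (H t) k) has_vector_derivative
    (\<Sum>a<k. matpow (H t) a ** X ** matpow (H t) (k - Suc a))) (at t within T)"
proof (induction k)
  case (Suc k)
  let ?D = "\<lambda>k. \<Sum>a<k. matpow (H t) a ** X ** matpow (H t) (k - Suc a)"
  have "((\<lambda>t. H t ** matpow (H t) k) has_vector_derivative H t ** ?D k + X ** matpow (H t) k)
      (at t within T)"
    using bounded_bilinear_matrix_matrix_mult H Suc.IH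
    by (rule bounded_bilinear.has_vector_derivative)
  moreover have "H t ** ?D k + X ** matpow (H t) k = ?D (Suc k)"
    unfolding sum.lessThan_Suc_shift
    by (simp add: bounded_bilinear.sum_right[OF bounded_bilinear_matrix_matrix_mult]
        matrix_mul_assoc)
  ultimately show ?case by simp
qed simp

lemma has_real_derivative_trace_mult_matpow:
  fixes H :: "real \<Rightarrow> real^'n^'n"
  assumes "(H has_vector_derivative X) (at t within T)"
  shows "((\<lambda>t. trace (Y ** matpow (H t) k)) has_real_derivative
    (\<Sum>a<k. trace (Y ** matpow (H t) a ** X ** matpow (H t) (k - Suc a)))) (at t within T)"
  using bounded_linear.has_vector_derivative[OF bounded_linear_trace_mult_left[of Y]
      has_vector_derivative_matpow[OF assms, of k]]
  by (simp add: has_real_derivative_iff_has_vector_derivative matrix_mul_assoc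
      linear_sum[OF bounded_linear.linear[OF bounded_linear_trace_mult_left]])

lemma has_real_derivative_trace_matpow:
  fixes H :: "real \<Rightarrow> real^'n^'n"
  assumes "(H has_vector_derivative X) (at t within T)"
  shows "((\<lambda>t. trace (matpow (H t) (Suc k))) has_real_derivative
    real (Suc k) * trace (X ** matpow (H t) k)) (at t within T)"
proof -
  have "trace (matpow (H t) a ** X ** matpow (H t) (k - a)) = trace (X ** matpow (H t) k)"
    if "a < Suc k" for a
  proof -
    have "trace (matpow (H t) a ** X ** matpow (H t) (k - a))
        = trace (X ** (matpow (H t) (k - a) ** matpow (H t) a))"
      by (metis matrix_mul_assoc trace_mul_sym)
    then show ?thesis
      using that by (simp add: matpow_add[symmetric])
  qed
  then have "(\<Sum>a<Suc k. trace (matpow (H t) a ** X ** matpow (H t) (k - a)))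
      = real (Suc k) * trace (X ** matpow (H t) k)"
    by simp
  then show ?thesis
    using has_real_derivative_trace_mult_matpow[OF assms, of "mat 1" "Suc k"]
    by (simp del: matpow.simps(2) sum.lessThan_Suc)
qed

lemma le_if_derivative_le:
  fixes f g :: "real \<Rightarrow> real"
  assumes "a \<le> b" and "f a \<le> g a"
    and f: "\<And>s. a \<le> s \<Longrightarrow> s \<le> b \<Longrightarrow> (f has_real_derivative f' s) (at s)"
    and g: "\<And>s. a \<le> s \<Longrightarrow> s \<le> b \<Longrightarrow> (g has_real_derivative g' s) (at s)"
    and le: "\<And>s. a \<le> s \<Longrightarrow> s \<le> b \<Longrightarrow> f' s \<le> g' s"
  shows "f b \<le> g b"
proof -
  have "g a - f a \<le> g b - f b"
  proof (rule DERIV_nonneg_imp_nondecreasing[OF \<open>a \<le> b\<close>], intro exI conjI)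
    fix s assume s: "a \<le> s" "s \<le> b"
    show "((\<lambda>s. g s - f s) has_real_derivative g' s - f' s) (at s)"
      by (intro DERIV_diff f g s)
    show "0 \<le> g' s - f' s"
      using le[OF s] by simp
  qed
  with \<open>f a \<le> g a\<close> show ?thesis by simp
qed

lemma le_if_second_derivative_le:
  fixes f g :: "real \<Rightarrow> real"
  assumes "a \<le> b" and "f a \<le> g a" and "f' a \<le> g' a"
    and "\<And>s. a \<le> s \<Longrightarrow> s \<le> b \<Longrightarrow> (f has_real_derivative f' s) (at s)"
    and "\<And>s. a \<le> s \<Longrightarrow> s \<le> b \<Longrightarrow> (g has_real_derivative g' s) (at s)"
    and "\<And>s. a \<le> s \<Longrightarrow> s \<le> b \<Longrightarrow> (f' has_real_derivative f'' s) (at s)"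
    and "\<And>s. a \<le> s \<Longrightarrow> s \<le> b \<Longrightarrow> (g' has_real_derivative g'' s) (at s)"
    and "\<And>s. a \<le> s \<Longrightarrow> s \<le> b \<Longrightarrow> f'' s \<le> g'' s"
  shows "f b \<le> g b"
proof (rule le_if_derivative_le[OF assms(1,2,4,5)])
  fix s assume "a \<le> s" "s \<le> b"
  show "f' s \<le> g' s"
    by (rule le_if_derivative_le[where a = a and f' = f'' and g' = g''])
      (use \<open>a \<le> s\<close> \<open>s \<le> b\<close> assms(3,6-8) in auto)
qed

section \<open>Trace moments of Gaussian size\<close>

lemma expectation_pmf_mono:
  fixes f g :: "'a \<Rightarrow> real"
  assumes "finite (set_pmf Q)" and "\<And>\<omega>. \<omega> \<in> set_pmf Q \<Longrightarrow> f \<omega> \<le> g \<omega>"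
  shows "measure_pmf.expectation Q f \<le> measure_pmf.expectation Q g"
  using assms
  by (intro integral_mono_AE integrable_measure_pmf_finite) (auto simp: AE_measure_pmf_iff)

lemma has_real_derivative_expectation_pmf:
  assumes "finite (set_pmf Q)"
    and "\<And>\<omega>. \<omega> \<in> set_pmf Q \<Longrightarrow> (f \<omega> has_real_derivative f' \<omega>) (at t within T)"
  shows "((\<lambda>t. measure_pmf.expectation Q (\<lambda>\<omega>. f \<omega> t)) has_real_derivative
    measure_pmf.expectation Q f') (at t within T)"
proof -
  have "measure_pmf.expectation Q h = (\<Sum>\<omega>\<in>set_pmf Q. h \<omega> * pmf Q \<omega>)" for h :: "'a \<Rightarrow> real"
    by (intro integral_measure_pmf_real assms(1))
  then show ?thesis
    by (auto intro!: DERIV_sum DERIV_cmult_right assms(2))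
qed

definition gaussian_even_moment :: "nat \<Rightarrow> real" where
  "gaussian_even_moment p = fact (2 * p) / (2 ^ p * fact p)"

lemma gaussian_even_moment_0: "gaussian_even_moment 0 = 1"
  by (simp add: gaussian_even_moment_def)

lemma gaussian_even_moment_Suc:
  "gaussian_even_moment (Suc p) = (2 * real p + 1) * gaussian_even_moment p"
proof -
  have "fact (2 * Suc p) = 2 * (1 + real p) * (2 * real p + 1) * fact (2 * p)"
    by (simp add: algebra_simps)
  then show ?thesis
    unfolding gaussian_even_moment_def by (simp add: divide_simps del: fact_Suc) simp
qed

lemma gaussian_even_moment_nonneg: "0 \<le> gaussian_even_moment p"
  by (simp add: gaussian_even_moment_def)

text \<open>The bound is the \<open>2p\<close>-th trace moment of \<open>gI\<close> for a centered Gaussian \<open>g\<close> of variance \<open>v\<close>.\<close>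

definition trace_subgaussian :: "'a pmf \<Rightarrow> ('a \<Rightarrow> real^'n^'n) \<Rightarrow> real \<Rightarrow> bool" where
  "trace_subgaussian Q H v \<longleftrightarrow>
    (\<forall>\<omega>\<in>set_pmf Q. transpose (H \<omega>) = H \<omega>) \<and>
    (\<forall>p. measure_pmf.expectation Q (\<lambda>\<omega>. trace (matpow (H \<omega>) (2 * p)))
      \<le> real CARD('n) * gaussian_even_moment p * v ^ p)"

lemma trace_subgaussianI:
  fixes H :: "'a \<Rightarrow> real^'n^'n"
  assumes "\<And>\<omega>. \<omega> \<in> set_pmf Q \<Longrightarrow> transpose (H \<omega>) = H \<omega>"
    and "\<And>p. measure_pmf.expectation Q (\<lambda>\<omega>. trace (matpow (H \<omega>) (2 * p)))
      \<le> real CARD('n) * gaussian_even_moment p * v ^ p"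
  shows "trace_subgaussian Q H v"
  using assms by (simp add: trace_subgaussian_def)

lemma trace_subgaussian_symmetric:
  "trace_subgaussian Q H v \<Longrightarrow> \<omega> \<in> set_pmf Q \<Longrightarrow> transpose (H \<omega>) = H \<omega>"
  by (simp add: trace_subgaussian_def)

lemma trace_subgaussian_moment_le:
  fixes H :: "'a \<Rightarrow> real^'n^'n"
  assumes "trace_subgaussian Q H v"
  shows "measure_pmf.expectation Q (\<lambda>\<omega>. trace (matpow (H \<omega>) (2 * p)))
    \<le> real CARD('n) * gaussian_even_moment p * v ^ p"
  using assms by (simp add: trace_subgaussian_def)

lemma trace_subgaussian_variance_nonneg:
  fixes H :: "'a \<Rightarrow> real^'n^'n"
  assumes "finite (set_pmf Q)" and "trace_subgaussian Q H v"
  shows "0 \<le> v"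
proof -
  have "0 \<le> measure_pmf.expectation Q (\<lambda>\<omega>. trace (matpow (H \<omega>) (2 * 1)))"
    using expectation_pmf_mono[OF assms(1), of "\<lambda>_. 0" "\<lambda>\<omega>. trace (matpow (H \<omega>) (2 * 1))"]
      trace_matpow_even[OF trace_subgaussian_symmetric[OF assms(2)], of _ 1] by simp
  also have "\<dots> \<le> real CARD('n) * v"
    using trace_subgaussian_moment_le[OF assms(2), of 1]
    by (simp add: gaussian_even_moment_Suc[of 0, simplified] gaussian_even_moment_0)
  finally show ?thesis by (simp add: zero_le_mult_iff)
qed

lemma trace_subgaussian_if_eq_on_set_pmf:
  assumes "trace_subgaussian Q H v" and eq: "\<And>\<omega>. \<omega> \<in> set_pmf Q \<Longrightarrow> H' \<omega> = H \<omega>"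
  shows "trace_subgaussian Q H' v"
proof -
  have "measure_pmf.expectation Q (\<lambda>\<omega>. trace (matpow (H' \<omega>) k))
      = measure_pmf.expectation Q (\<lambda>\<omega>. trace (matpow (H \<omega>) k))" for k
    by (intro integral_cong_AE) (simp_all add: AE_measure_pmf_iff eq)
  then show ?thesis
    using assms by (simp add: trace_subgaussian_def)
qed

lemma trace_subgaussian_zero: "trace_subgaussian Q (\<lambda>_. 0 :: real^'n^'n) 0"
proof (rule trace_subgaussianI)
  show "measure_pmf.expectation Q (\<lambda>_. trace (matpow (0 :: real^'n^'n) (2 * p)))
      \<le> real CARD('n) * gaussian_even_moment p * 0 ^ p" for p
    by (cases p) (simp_all add: trace_I trace_0[simplified] gaussian_even_moment_0)
qed (simp add: transpose_def vec_eq_iff)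

lemma trace_subgaussian_map_pmf:
  "trace_subgaussian (map_pmf f Q) H v \<longleftrightarrow> trace_subgaussian Q (\<lambda>\<omega>. H (f \<omega>)) v"
  by (simp add: trace_subgaussian_def)

lemma sum_trace_matpow_sandwich_le:
  fixes H X :: "real^'n^'n"
  assumes "transpose H = H" and "transpose X = X" and "spectral_norm X \<le> c"
  shows "(\<Sum>a<2 * p + 1. trace (X ** matpow H a ** X ** matpow H (2 * p + 1 - Suc a)))
    \<le> (2 * real p + 1) * c\<^sup>2 * trace (matpow H (2 * p))"
proof -
  have "trace (X ** matpow H a ** X ** matpow H (2 * p + 1 - Suc a))
      \<le> c\<^sup>2 * trace (matpow H (2 * p))"
    if "a < 2 * p + 1" for a
  proof -
    have "trace (X ** matpow H a ** X ** matpow H (2 * p + 1 - Suc a))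
        \<le> (spectral_norm X)\<^sup>2 * trace (matpow H (2 * p))"
      using trace_matpow_sandwich_le[OF assms(1), of a "2 * p + 1 - Suc a" p X] assms(2) that
      by simp
    also have "\<dots> \<le> c\<^sup>2 * trace (matpow H (2 * p))"
      using assms
      by (intro mult_right_mono power_mono spectral_norm_nonneg) (simp_all add: trace_matpow_even)
    finally show ?thesis .
  qed
  then have "(\<Sum>a<2 * p + 1. trace (X ** matpow H a ** X ** matpow H (2 * p + 1 - Suc a)))
      \<le> (\<Sum>a<2 * p + 1. c\<^sup>2 * trace (matpow H (2 * p)))"
    by (intro sum_mono) simp
  then show ?thesis by (simp add: algebra_simps)
qed

lemma expectation_sum_trace_matpow_sandwich_le:
  fixes H X :: "'a \<Rightarrow> real^'n^'n"
  assumes "finite (set_pmf Q)"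
    and "\<And>\<omega>. \<omega> \<in> set_pmf Q \<Longrightarrow> transpose (H \<omega>) = H \<omega>"
    and "\<And>\<omega>. \<omega> \<in> set_pmf Q \<Longrightarrow> transpose (X \<omega>) = X \<omega>"
    and "\<And>\<omega>. \<omega> \<in> set_pmf Q \<Longrightarrow> spectral_norm (X \<omega>) \<le> c"
  shows "measure_pmf.expectation Q
      (\<lambda>\<omega>. \<Sum>a<2 * p + 1. trace (X \<omega> ** matpow (H \<omega>) a ** X \<omega> ** matpow (H \<omega>) (2 * p + 1 - Suc a)))
    \<le> (2 * real p + 1) * c\<^sup>2 * measure_pmf.expectation Q (\<lambda>\<omega>. trace (matpow (H \<omega>) (2 * p)))"
  unfolding integral_mult_right_zero[symmetric]
  by (intro expectation_pmf_mono sum_trace_matpow_sandwich_le assms)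

lemma has_real_derivative_power_affine_square:
  "((\<lambda>t::real. (v + b * t\<^sup>2) ^ k) has_real_derivative
    real k * (v + b * t\<^sup>2) ^ (k - 1) * (2 * b * t)) (at t within T)"
  by (auto intro!: derivative_eq_intros)

lemma gaussian_even_moment_comparison:
  fixes f f' f'' :: "real \<Rightarrow> real"
  assumes "0 \<le> K" and "0 \<le> v" and "0 \<le> t"
    and f0: "f 0 \<le> K * gaussian_even_moment (Suc p) * v ^ Suc p" and "f' 0 = 0"
    and f: "\<And>s. (f has_real_derivative f' s) (at s)"
    and f': "\<And>s. (f' has_real_derivative f'' s) (at s)"
    and f''_le: "\<And>s. 0 \<le> s \<Longrightarrow>
      f'' s \<le> (2 * real p + 2) * (2 * real p + 1) * b *
        (K * gaussian_even_moment p * (v + b * s\<^sup>2) ^ p)"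
    and "0 \<le> b"
  shows "f t \<le> K * gaussian_even_moment (Suc p) * (v + b * t\<^sup>2) ^ Suc p"
proof -
  let ?w = "\<lambda>t. v + b * t\<^sup>2"
  define C where "C = K * gaussian_even_moment (Suc p)"
  define g where "g t = C * ?w t ^ Suc p" for t
  define g' where "g' t = C * real (Suc p) * (?w t ^ p * (2 * b * t))" for t
  define g'' where "g'' t = C * real (Suc p) *
    (real p * ?w t ^ (p - 1) * (2 * b * t) * (2 * b * t) + 2 * b * ?w t ^ p)" for t
  have "f t \<le> g t"
  proof (rule le_if_second_derivative_le[OF \<open>0 \<le> t\<close> _ _ f _ f'])
    show "f 0 \<le> g 0" "f' 0 \<le> g' 0"
      using f0 \<open>f' 0 = 0\<close> by (simp_all add: g_def g'_def C_def)
    fix s :: real assume "0 \<le> s"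
    show "(g has_real_derivative g' s) (at s)"
      using DERIV_cmult[OF has_real_derivative_power_affine_square[of v b "Suc p" s], of C]
      by (simp add: g_def[abs_def] g'_def mult.assoc)
    show "(g' has_real_derivative g'' s) (at s)"
      unfolding g'_def[abs_def] g''_def
      by (intro DERIV_cmult DERIV_mult has_real_derivative_power_affine_square)
        (auto intro!: derivative_eq_intros)
    have "f'' s \<le> C * real (Suc p) * (2 * b * ?w s ^ p)"
      using f''_le[OF \<open>0 \<le> s\<close>] by (simp add: C_def gaussian_even_moment_Suc algebra_simps)
    also have "\<dots> \<le> g'' s"
      unfolding g''_def C_def
      using \<open>0 \<le> K\<close> \<open>0 \<le> v\<close> \<open>0 \<le> b\<close> \<open>0 \<le> s\<close> gaussian_even_moment_nonneg
      by (intro mult_left_mono) simp_all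
    finally show "f'' s \<le> g'' s" .
  qed
  then show ?thesis by (simp add: g_def C_def)
qed

lemma trace_subgaussian_moment_line_le:
  fixes S X :: "'a \<Rightarrow> real^'n^'n"
  assumes finite: "finite (set_pmf Q)" and S: "trace_subgaussian Q S v"
    and X_sym: "\<And>\<omega>. \<omega> \<in> set_pmf Q \<Longrightarrow> transpose (X \<omega>) = X \<omega>"
    and X_le: "\<And>\<omega>. \<omega> \<in> set_pmf Q \<Longrightarrow> spectral_norm (X \<omega>) \<le> c"
    and centered: "\<And>k. measure_pmf.expectation Q (\<lambda>\<omega>. trace (X \<omega> ** matpow (S \<omega>) k)) = 0"
    and "0 \<le> t"
  shows "measure_pmf.expectation Q (\<lambda>\<omega>. trace (matpow (S \<omega> + t *\<^sub>R X \<omega>) (2 * p)))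
    \<le> real CARD('n) * gaussian_even_moment p * (v + c\<^sup>2 * t\<^sup>2) ^ p"
  using \<open>0 \<le> t\<close>
proof (induction p arbitrary: t)
  case 0
  then show ?case by (simp add: trace_I gaussian_even_moment_0)
next
  case (Suc p)
  let ?H = "\<lambda>t \<omega>. S \<omega> + t *\<^sub>R X \<omega>"
  let ?E = "measure_pmf.expectation Q"
  let ?k = "2 * p + 1"
  define f where "f t = ?E (\<lambda>\<omega>. trace (matpow (?H t \<omega>) (Suc ?k)))" for t
  define f' where "f' t = real (Suc ?k) * ?E (\<lambda>\<omega>. trace (X \<omega> ** matpow (?H t \<omega>) ?k))" for t
  define f'' where "f'' t = real (Suc ?k) * ?E (\<lambda>\<omega>.
      \<Sum>a<?k. trace (X \<omega> ** matpow (?H t \<omega>) a ** X \<omega> ** matpow (?H t \<omega>) (?k - Suc a)))" for t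
  have line: "((\<lambda>t. ?H t \<omega>) has_vector_derivative X \<omega>) (at s)" for \<omega> s
    by (auto intro!: derivative_eq_intros)
  have "f t \<le> real CARD('n) * gaussian_even_moment (Suc p) * (v + c\<^sup>2 * t\<^sup>2) ^ Suc p"
  proof (rule gaussian_even_moment_comparison[OF _ _ Suc.prems])
    show "f 0 \<le> real CARD('n) * gaussian_even_moment (Suc p) * v ^ Suc p"
      using trace_subgaussian_moment_le[OF S, of "Suc p"] by (simp add: f_def del: matpow.simps)
    show "f' 0 = 0"
      using centered[of ?k] by (simp add: f'_def del: matpow.simps)
    show "(f has_real_derivative f' s) (at s)" for s
      unfolding f_def[abs_def] f'_def integral_mult_right_zero[symmetric]
      by (intro has_real_derivative_expectation_pmf finite has_real_derivative_trace_matpow line)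
    show "(f' has_real_derivative f'' s) (at s)" for s
      unfolding f'_def[abs_def] f''_def
      by (intro DERIV_cmult has_real_derivative_expectation_pmf finite
          has_real_derivative_trace_mult_matpow line)
    fix s :: real assume "0 \<le> s"
    have "f'' s \<le> real (Suc ?k) *
        ((2 * real p + 1) * c\<^sup>2 * ?E (\<lambda>\<omega>. trace (matpow (?H s \<omega>) (2 * p))))"
      unfolding f''_def
      by (intro mult_left_mono expectation_sum_trace_matpow_sandwich_le finite X_sym X_le)
        (simp_all add: transpose_add transpose_scalar trace_subgaussian_symmetric[OF S] X_sym)
    also have "\<dots> \<le> real (Suc ?k) *
        ((2 * real p + 1) * c\<^sup>2 * (real CARD('n) * gaussian_even_moment p * (v + c\<^sup>2 * s\<^sup>2) ^ p))"
      by (intro mult_left_mono Suc.IH \<open>0 \<le> s\<close>) simp_all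
    finally show "f'' s \<le> (2 * real p + 2) * (2 * real p + 1) * c\<^sup>2 *
        (real CARD('n) * gaussian_even_moment p * (v + c\<^sup>2 * s\<^sup>2) ^ p)"
      by (simp add: mult.assoc add.commute)
  qed (simp_all add: trace_subgaussian_variance_nonneg[OF finite S])
  then show ?case by (simp add: f_def)
qed

lemma trace_subgaussian_martingale_step:
  fixes S X :: "'a \<Rightarrow> real^'n^'n"
  assumes "finite (set_pmf Q)" and S: "trace_subgaussian Q S v"
    and X: "\<And>\<omega>. \<omega> \<in> set_pmf Q \<Longrightarrow> transpose (X \<omega>) = X \<omega>"
    and "\<And>\<omega>. \<omega> \<in> set_pmf Q \<Longrightarrow> spectral_norm (X \<omega>) \<le> c"
    and "\<And>k. measure_pmf.expectation Q (\<lambda>\<omega>. trace (X \<omega> ** matpow (S \<omega>) k)) = 0"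
  shows "trace_subgaussian Q (\<lambda>\<omega>. S \<omega> + X \<omega>) (v + c\<^sup>2)"
proof (rule trace_subgaussianI)
  show "measure_pmf.expectation Q (\<lambda>\<omega>. trace (matpow (S \<omega> + X \<omega>) (2 * p)))
      \<le> real CARD('n) * gaussian_even_moment p * (v + c\<^sup>2) ^ p" for p
    using trace_subgaussian_moment_line_le[OF assms, of 1 p] by simp
qed (simp add: transpose_add trace_subgaussian_symmetric[OF S] X)

lemma even_power_sums_cosh: "(\<lambda>p. x ^ (2 * p) / fact (2 * p)) sums cosh x" for x :: real
proof -
  have "(\<lambda>n. if even n then x ^ n / fact n else 0) sums cosh x"
    using cosh_converges[of x]
    by (simp add: scaleR_conv_of_real divide_inverse mult.commute cong: if_cong)
  then show ?thesis
    by (subst (asm) sums_mono_reindex[of "\<lambda>p. 2 * p", symmetric])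
      (auto simp: strict_mono_def elim!: evenE)
qed

lemma gaussian_even_moment_sums_exp:
  "(\<lambda>p. gaussian_even_moment p * v ^ p * (\<theta> ^ (2 * p) / fact (2 * p))) sums exp (\<theta>\<^sup>2 * v / 2)"
proof -
  have "gaussian_even_moment p * v ^ p * (\<theta> ^ (2 * p) / fact (2 * p))
      = (\<theta>\<^sup>2 * v / 2) ^ p /\<^sub>R fact p" for p
    by (simp add: gaussian_even_moment_def power_mult_distrib power_divide field_simps
        flip: power_mult)
  then show ?thesis
    using exp_converges[of "\<theta>\<^sup>2 * v / 2"] by simp
qed

text \<open>The moment bounds are summed against the series of \<open>cosh (\<theta>\<epsilon>)\<close> with \<open>\<theta> = \<epsilon>/v\<close>;
  the factor 2 is lost in \<open>exp \<le> 2 cosh\<close>.\<close>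

lemma gaussian_even_moments_imp_tail:
  fixes P \<epsilon> v D :: real
  assumes moments: "\<And>p. P * \<epsilon> ^ (2 * p) \<le> D * (gaussian_even_moment p * v ^ p)"
    and "0 < v" and "0 \<le> P"
  shows "P \<le> 2 * D * exp (- \<epsilon>\<^sup>2 / (2 * v))"
proof -
  define \<theta> where "\<theta> = \<epsilon> / v"
  have "P * cosh (\<theta> * \<epsilon>) \<le> D * exp (\<theta>\<^sup>2 * v / 2)"
  proof (rule sums_le)
    show "(\<lambda>p. P * ((\<theta> * \<epsilon>) ^ (2 * p) / fact (2 * p))) sums (P * cosh (\<theta> * \<epsilon>))"
      by (rule sums_mult[OF even_power_sums_cosh])
    show "(\<lambda>p. D * (gaussian_even_moment p * v ^ p * (\<theta> ^ (2 * p) / fact (2 * p))))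
        sums (D * exp (\<theta>\<^sup>2 * v / 2))"
      by (rule sums_mult[OF gaussian_even_moment_sums_exp])
    fix p
    have "(P * \<epsilon> ^ (2 * p)) * (\<theta> ^ (2 * p) / fact (2 * p))
        \<le> (D * (gaussian_even_moment p * v ^ p)) * (\<theta> ^ (2 * p) / fact (2 * p))"
      by (intro mult_right_mono moments) simp
    then show "P * ((\<theta> * \<epsilon>) ^ (2 * p) / fact (2 * p))
        \<le> D * (gaussian_even_moment p * v ^ p * (\<theta> ^ (2 * p) / fact (2 * p)))"
      by (simp add: power_mult_distrib mult_ac)
  qed
  moreover have "P * (exp (\<theta> * \<epsilon>) / 2) \<le> P * cosh (\<theta> * \<epsilon>)"
    using \<open>0 \<le> P\<close> by (intro mult_left_mono) (simp_all add: cosh_def)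
  ultimately have "P * exp (\<theta> * \<epsilon>) \<le> 2 * D * exp (\<theta>\<^sup>2 * v / 2)"
    by simp
  then have "P \<le> 2 * D * (exp (\<theta>\<^sup>2 * v / 2) / exp (\<theta> * \<epsilon>))"
    by (simp add: field_simps)
  also have "exp (\<theta>\<^sup>2 * v / 2) / exp (\<theta> * \<epsilon>) = exp (- \<epsilon>\<^sup>2 / (2 * v))"
    using \<open>0 < v\<close> by (simp add: exp_diff[symmetric] \<theta>_def power2_eq_square field_simps)
  finally show ?thesis .
qed

lemma trace_subgaussian_tail:
  fixes H :: "'a \<Rightarrow> real^'n^'n"
  assumes finite: "finite (set_pmf Q)" and subgaussian: "trace_subgaussian Q H v"
    and "0 < v" and "0 \<le> \<epsilon>"
  shows "measure_pmf.prob Q {\<omega>. \<epsilon> \<le> spectral_norm (H \<omega>)}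
    \<le> 2 * real CARD('n) * exp (- \<epsilon>\<^sup>2 / (2 * v))"
proof (rule gaussian_even_moments_imp_tail[OF _ \<open>0 < v\<close>])
  fix p
  let ?A = "{\<omega>. \<epsilon> \<le> spectral_norm (H \<omega>)}"
  have "measure_pmf.prob Q ?A * \<epsilon> ^ (2 * p)
      = measure_pmf.expectation Q (\<lambda>\<omega>. indicator ?A \<omega> * \<epsilon> ^ (2 * p))"
    by simp
  also have "\<dots> \<le> measure_pmf.expectation Q (\<lambda>\<omega>. trace (matpow (H \<omega>) (2 * p)))"
  proof (rule expectation_pmf_mono[OF finite])
    fix \<omega> assume "\<omega> \<in> set_pmf Q"
    then have "spectral_norm (H \<omega>) ^ (2 * p) \<le> trace (matpow (H \<omega>) (2 * p))"
      by (intro spectral_norm_power_le_trace_matpow trace_subgaussian_symmetric[OF subgaussian])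
    moreover have "indicator ?A \<omega> * \<epsilon> ^ (2 * p) \<le> spectral_norm (H \<omega>) ^ (2 * p)"
      using \<open>0 \<le> \<epsilon>\<close> by (auto simp: indicator_def power_mono spectral_norm_nonneg)
    ultimately show "indicator ?A \<omega> * \<epsilon> ^ (2 * p) \<le> trace (matpow (H \<omega>) (2 * p))"
      by (rule order_trans[rotated])
  qed
  also have "\<dots> \<le> real CARD('n) * (gaussian_even_moment p * v ^ p)"
    using trace_subgaussian_moment_le[OF subgaussian] by (simp add: mult.assoc)
  finally show "measure_pmf.prob Q ?A * \<epsilon> ^ (2 * p)
      \<le> real CARD('n) * (gaussian_even_moment p * v ^ p)" .
qed simp

section \<open>Sampling without replacement\<close>

lemma set_pmf_unif_perm: "set_pmf (unif_perm N) = {\<pi>. \<pi> permutes {..<N}}"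
  unfolding unif_perm_def using permutes_id[of "{..<N}"]
  by (intro set_pmf_of_set finite_permutations) blast+

lemma finite_set_pmf_unif_perm: "finite (set_pmf (unif_perm N))"
  by (simp add: set_pmf_unif_perm finite_permutations)

lemma unif_perm_less: "\<pi> \<in> set_pmf (unif_perm N) \<Longrightarrow> i < N \<Longrightarrow> \<pi> i < N"
  using permutes_in_image[of \<pi> "{..<N}" i] by (simp add: set_pmf_unif_perm)

lemma map_pmf_unif_perm_comp:
  assumes "\<tau> permutes {..<N}"
  shows "map_pmf (\<lambda>\<pi>. \<pi> \<circ> \<tau>) (unif_perm N) = unif_perm N"
  unfolding unif_perm_def
proof (rule map_pmf_of_set_bij_betw)
  show "bij_betw (\<lambda>\<pi>. \<pi> \<circ> \<tau>) {\<pi>. \<pi> permutes {..<N}} {\<pi>. \<pi> permutes {..<N}}"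
    by (rule bij_betw_byWitness[where f' = "\<lambda>\<pi>. \<pi> \<circ> inv \<tau>"])
      (use assms in \<open>auto simp: o_assoc[symmetric] permutes_inv_o permutes_compose permutes_inv\<close>)
  show "{\<pi>. \<pi> permutes {..<N}} \<noteq> {}"
    using permutes_id by blast
qed (simp add: finite_permutations)

lemma map_pmf_unif_perm_random_swap:
  assumes "j < N"
  shows "map_pmf (\<lambda>(\<pi>, i). \<pi> \<circ> Transposition.transpose i j)
    (pair_pmf (unif_perm N) (pmf_of_set {..j})) = unif_perm N"
proof -
  let ?swap = "\<lambda>\<pi> i. \<pi> \<circ> Transposition.transpose i j"
  have "map_pmf (\<lambda>(\<pi>, i). ?swap \<pi> i) (pair_pmf (unif_perm N) (pmf_of_set {..j}))
      = bind_pmf (unif_perm N) (\<lambda>\<pi>. bind_pmf (pmf_of_set {..j}) (\<lambda>i. return_pmf (?swap \<pi> i)))"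
    by (simp add: pair_pmf_def map_bind_pmf)
  also have "\<dots> = bind_pmf (pmf_of_set {..j}) (\<lambda>i. map_pmf (\<lambda>\<pi>. ?swap \<pi> i) (unif_perm N))"
    unfolding map_pmf_def by (rule bind_commute_pmf)
  also have "\<dots> = bind_pmf (pmf_of_set {..j}) (\<lambda>_. unif_perm N)"
    using assms by (intro bind_pmf_cong map_pmf_unif_perm_comp permutes_swap_id) auto
  finally show ?thesis by simp
qed

lemma expectation_trace_mult_pair_pmf_eq_0:
  fixes X :: "'a \<Rightarrow> 'b \<Rightarrow> real^'n^'n"
  assumes "finite (set_pmf Q)" and "finite (set_pmf R)"
    and "\<And>\<omega>. \<omega> \<in> set_pmf Q \<Longrightarrow> measure_pmf.expectation R (X \<omega>) = 0"
  shows "measure_pmf.expectation (pair_pmf Q R) (\<lambda>(\<omega>, i). trace (X \<omega> i ** Y \<omega>)) = 0"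
proof -
  have "measure_pmf.expectation R (\<lambda>i. trace (X \<omega> i ** Y \<omega>)) = 0" if "\<omega> \<in> set_pmf Q" for \<omega>
    using integral_bounded_linear[OF bounded_linear_trace_mult_right[of "Y \<omega>"]
        integrable_measure_pmf_finite[OF assms(2)], of "X \<omega>"] assms(3)[OF that]
    by (simp add: trace_0[simplified])
  then show ?thesis
    unfolding pair_pmf_def map_pmf_def[symmetric]
    using assms by (subst pmf_expectation_bind[OF assms(1)]) (auto simp flip: map_pmf_def)
qed

definition sample_mean :: "(nat \<Rightarrow> 'a::real_vector) \<Rightarrow> nat \<Rightarrow> (nat \<Rightarrow> nat) \<Rightarrow> 'a" where
  "sample_mean B n \<pi> = (1 / real n) *\<^sub>R (\<Sum>i<n. B (\<pi> i))"

lemma linear_sample_mean: "linear f \<Longrightarrow> f (sample_mean B n \<pi>) = sample_mean (\<lambda>i. f (B i)) n \<pi>"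
  by (simp add: sample_mean_def linear_cmul linear_sum)

lemma sample_mean_cong:
  "(\<And>i. i < n \<Longrightarrow> B (\<pi> i) = C (\<pi> i)) \<Longrightarrow> sample_mean B n \<pi> = sample_mean C n \<pi>"
  by (simp add: sample_mean_def)

lemma sample_mean_permutes: "\<pi> permutes {..<N} \<Longrightarrow> sample_mean B N \<pi> = sample_mean B N id"
  using sum.permute[of \<pi> "{..<N}" B] by (simp add: sample_mean_def o_def)

lemma sum_eq_scaleR_sample_mean: "(\<Sum>i\<le>j. B (\<pi> i)) = real (Suc j) *\<^sub>R sample_mean B (Suc j) \<pi>"
  by (simp add: sample_mean_def lessThan_Suc_atMost del: of_nat_Suc)

lemma expectation_sample_mean_deviation:
  fixes B :: "nat \<Rightarrow> 'a::{banach, second_countable_topology}"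
  shows "measure_pmf.expectation (pmf_of_set {..j}) (\<lambda>i. sample_mean B (Suc j) \<pi> - B (\<pi> i)) = 0"
proof -
  have "(\<Sum>i\<le>j. sample_mean B (Suc j) \<pi> - B (\<pi> i)) = 0"
    by (simp only: sum_subtractf sum_constant_scaleR card_atMost sum_eq_scaleR_sample_mean
        diff_self)
  then show ?thesis
    by (subst integral_measure_pmf[of "{..j}"]) (simp_all flip: scaleR_sum_right)
qed

lemma sample_mean_swap:
  assumes "1 \<le> j" and "i \<le> j"
  shows "sample_mean B j (\<pi> \<circ> Transposition.transpose i j)
    = sample_mean B (Suc j) \<pi> + (1 / real j) *\<^sub>R (sample_mean B (Suc j) \<pi> - B (\<pi> i))"
proof -
  have "(\<Sum>k\<le>j. B ((\<pi> \<circ> Transposition.transpose i j) k)) = (\<Sum>k\<le>j. B (\<pi> k))"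
    using sum.permute[OF permutes_swap_id[of i "{..j}" j], of "B \<circ> \<pi>"] assms by (simp add: o_def)
  then have swap: "(\<Sum>k<j. B ((\<pi> \<circ> Transposition.transpose i j) k))
      = real (Suc j) *\<^sub>R sample_mean B (Suc j) \<pi> - B (\<pi> i)"
    by (simp add: sum_eq_scaleR_sample_mean[symmetric] lessThan_Suc_atMost[symmetric]
        algebra_simps del: of_nat_Suc)
  show ?thesis
    unfolding sample_mean_def[of B j] swap using assms(1) by (simp add: algebra_simps)
qed

lemma spectral_norm_sample_mean_le:
  fixes B :: "nat \<Rightarrow> real^'n^'m"
  assumes "1 \<le> n" and "\<And>i. i < n \<Longrightarrow> spectral_norm (B (\<pi> i)) \<le> \<sigma>"
  shows "spectral_norm (sample_mean B n \<pi>) \<le> \<sigma>"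
proof -
  have "spectral_norm (\<Sum>i<n. B (\<pi> i)) \<le> (\<Sum>i<n. \<sigma>)"
    using assms(2) by (intro order_trans[OF spectral_norm_sum_le] sum_mono) simp
  then show ?thesis
    using assms(1) by (simp add: sample_mean_def spectral_norm_scaleR field_simps)
qed

lemma spectral_norm_sample_mean_deviation_le:
  fixes B :: "nat \<Rightarrow> real^'n^'m"
  assumes "\<And>i. i \<le> j \<Longrightarrow> spectral_norm (B (\<pi> i)) \<le> \<sigma>" and "i \<le> j"
  shows "spectral_norm (sample_mean B (Suc j) \<pi> - B (\<pi> i)) \<le> 2 * \<sigma>"
proof -
  have "spectral_norm (sample_mean B (Suc j) \<pi>) \<le> \<sigma>"
    using assms(1) by (intro spectral_norm_sample_mean_le) auto
  then show ?thesis
    using spectral_norm_diff_le[of "sample_mean B (Suc j) \<pi>" "B (\<pi> i)"] assms(1)[OF assms(2)]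
    by simp
qed

lemma transpose_sample_mean:
  fixes B :: "nat \<Rightarrow> real^'n^'n"
  assumes "\<And>i. i < n \<Longrightarrow> transpose (B (\<pi> i)) = B (\<pi> i)"
  shows "transpose (sample_mean B n \<pi>) = sample_mean B n \<pi>"
  using assms by (simp add: linear_sample_mean[OF linear_transpose] cong: sample_mean_cong)

text \<open>Passing from \<open>j + 1\<close> to \<open>j\<close> samples, discard a uniformly chosen one of the \<open>j + 1\<close>.\<close>

lemma trace_subgaussian_sample_mean_step:
  fixes B :: "nat \<Rightarrow> real^'n^'n"
  assumes B_sym: "\<And>i. i < N \<Longrightarrow> transpose (B i) = B i"
    and B_le: "\<And>i. i < N \<Longrightarrow> spectral_norm (B i) \<le> \<sigma>"
    and "1 \<le> j" and "j < N"
    and subgaussian: "trace_subgaussian (unif_perm N) (\<lambda>\<pi>. sample_mean B (Suc j) \<pi> - Z) v"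
  shows "trace_subgaussian (unif_perm N) (\<lambda>\<pi>. sample_mean B j \<pi> - Z) (v + (2 * \<sigma> / real j)\<^sup>2)"
proof -
  let ?Q = "pair_pmf (unif_perm N) (pmf_of_set {..j})"
  let ?swap = "\<lambda>(\<pi>, i). \<pi> \<circ> Transposition.transpose i j"
  define M where "M \<omega> = sample_mean B (Suc j) (fst \<omega>)" for \<omega> :: "(nat \<Rightarrow> nat) \<times> nat"
  define X where "X \<omega> = (1 / real j) *\<^sub>R (M \<omega> - B (fst \<omega> (snd \<omega>)))" for \<omega>
  have martingale: "trace_subgaussian ?Q (\<lambda>\<omega>. (M \<omega> - Z) + X \<omega>) (v + (2 * \<sigma> / real j)\<^sup>2)"
  proof (rule trace_subgaussian_martingale_step)
    show "finite (set_pmf ?Q)"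
      by (simp add: finite_set_pmf_unif_perm)
    show "trace_subgaussian ?Q (\<lambda>\<omega>. M \<omega> - Z) v"
      using subgaussian trace_subgaussian_map_pmf[of fst ?Q "\<lambda>\<pi>. sample_mean B (Suc j) \<pi> - Z" v]
      by (simp add: map_fst_pair_pmf M_def)
    show "measure_pmf.expectation ?Q (\<lambda>\<omega>. trace (X \<omega> ** matpow (M \<omega> - Z) k)) = 0" for k
      unfolding X_def M_def
      by (rule expectation_trace_mult_pair_pmf_eq_0[unfolded case_prod_unfold])
        (simp_all add: finite_set_pmf_unif_perm expectation_sample_mean_deviation)
    fix \<omega> assume "\<omega> \<in> set_pmf ?Q"
    then have "fst \<omega> \<in> set_pmf (unif_perm N)" and "snd \<omega> \<le> j"
      by auto
    then have less: "fst \<omega> i < N" if "i \<le> j" for i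
      using that \<open>j < N\<close> by (simp add: unif_perm_less)
    have "transpose (M \<omega>) = M \<omega>"
      unfolding M_def using less by (intro transpose_sample_mean) (simp add: B_sym)
    then show "transpose (X \<omega>) = X \<omega>"
      using less[OF \<open>snd \<omega> \<le> j\<close>]
      by (simp add: X_def transpose_scalar linear_diff[OF linear_transpose] B_sym)
    have "spectral_norm (M \<omega> - B (fst \<omega> (snd \<omega>))) \<le> 2 * \<sigma>"
      unfolding M_def using less \<open>snd \<omega> \<le> j\<close>
      by (intro spectral_norm_sample_mean_deviation_le B_le) auto
    then show "spectral_norm (X \<omega>) \<le> 2 * \<sigma> / real j"
      by (simp add: X_def spectral_norm_scaleR divide_right_mono)
  qed
  have "trace_subgaussian ?Q (\<lambda>\<omega>. sample_mean B j (?swap \<omega>) - Z) (v + (2 * \<sigma> / real j)\<^sup>2)"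
    by (rule trace_subgaussian_if_eq_on_set_pmf[OF martingale])
      (use \<open>1 \<le> j\<close> in \<open>auto simp: X_def M_def sample_mean_swap\<close>)
  then show ?thesis
    using trace_subgaussian_map_pmf[of ?swap ?Q "\<lambda>\<pi>. sample_mean B j \<pi> - Z"]
      map_pmf_unif_perm_random_swap[OF \<open>j < N\<close>] by simp
qed

lemma trace_subgaussian_sample_mean:
  fixes B :: "nat \<Rightarrow> real^'n^'n"
  assumes B_sym: "\<And>i. i < N \<Longrightarrow> transpose (B i) = B i"
    and B_le: "\<And>i. i < N \<Longrightarrow> spectral_norm (B i) \<le> \<sigma>"
    and "1 \<le> n" and "n \<le> N"
  shows "trace_subgaussian (unif_perm N) (\<lambda>\<pi>. sample_mean B n \<pi> - sample_mean B N id)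
    (4 * \<sigma>\<^sup>2 * (\<Sum>j = n..<N. 1 / (real j)\<^sup>2))"
  using \<open>n \<le> N\<close>
proof (induction rule: inc_induct)
  case base
  have variance: "4 * \<sigma>\<^sup>2 * (\<Sum>j = N..<N. 1 / (real j)\<^sup>2) = 0"
    by simp
  show ?case
    unfolding variance by (rule trace_subgaussian_if_eq_on_set_pmf[OF trace_subgaussian_zero])
      (simp only: set_pmf_unif_perm mem_Collect_eq sample_mean_permutes diff_self)
next
  case (step j)
  have "4 * \<sigma>\<^sup>2 * (\<Sum>j = j..<N. 1 / (real j)\<^sup>2)
      = 4 * \<sigma>\<^sup>2 * (\<Sum>j = Suc j..<N. 1 / (real j)\<^sup>2) + (2 * \<sigma> / real j)\<^sup>2"
    using step.hyps
    by (simp add: sum.atLeast_Suc_lessThan power_divide power_mult_distrib algebra_simps)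
  then show ?case
    using trace_subgaussian_sample_mean_step[OF B_sym B_le _ _ step.IH] step.hyps \<open>1 \<le> n\<close> by simp
qed

lemma sum_inverse_squares_le:
  fixes n N :: nat
  assumes "1 \<le> n" and "n \<le> N"
  shows "(\<Sum>j = n..<N. 1 / (real j)\<^sup>2) \<le> (1 + 1 / real n) * (1 - real n / real N) / real n"
proof -
  have "(\<Sum>j = n..<N. 1 / (real j)\<^sup>2)
      \<le> (\<Sum>j = n..<N. (1 + 1 / real n) * (1 / real j - 1 / real (Suc j)))"
  proof (rule sum_mono)
    fix j assume "j \<in> {n..<N}"
    then have "0 < real n" "real n \<le> real j" using assms by auto
    then have "1 / (real j)\<^sup>2 = (1 + 1 / real j) * (1 / real j - 1 / real (Suc j))"
      by (simp add: divide_simps power2_eq_square)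
    also have "\<dots> \<le> (1 + 1 / real n) * (1 / real j - 1 / real (Suc j))"
      using \<open>0 < real n\<close> \<open>real n \<le> real j\<close> by (intro mult_right_mono) (simp_all add: frac_le)
    finally show "1 / (real j)\<^sup>2 \<le> (1 + 1 / real n) * (1 / real j - 1 / real (Suc j))" .
  qed
  also have "\<dots> = (1 + 1 / real n) * (1 / real n - 1 / real N)"
    using sum_Suc_diff'[OF \<open>n \<le> N\<close>, of "\<lambda>j. - 1 / real j"]
    unfolding sum_distrib_left[symmetric] by simp
  also have "1 / real n - 1 / real N = (1 - real n / real N) / real n"
    using assms by (simp add: diff_divide_distrib)
  finally show ?thesis by simp
qed

section \<open>Hermitian dilation\<close>

definition dilation :: "'a::zero^'n^'m \<Rightarrow> 'a^('m + 'n)^('m + 'n)" where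
  "dilation A = (\<chi> i j. case (i, j) of
    (Inl a, Inr b) \<Rightarrow> A $ a $ b | (Inr b, Inl a) \<Rightarrow> A $ a $ b | _ \<Rightarrow> 0)"

lemma transpose_dilation: "transpose (dilation A) = dilation A"
  by (auto simp: vec_eq_iff transpose_def dilation_def split: sum.splits)

lemma linear_dilation: "linear (dilation :: real^'n^'m \<Rightarrow> _)"
  by (rule linearI) (auto simp: vec_eq_iff dilation_def split: sum.splits)

lemma sum_UNIV_sum_type:
  "(\<Sum>i\<in>UNIV. f i) = (\<Sum>a\<in>UNIV. f (Inl a)) + (\<Sum>b\<in>UNIV. f (Inr b))"
  for f :: "'a::finite + 'b::finite \<Rightarrow> 'c::comm_monoid_add"
  by (simp add: UNIV_Plus_UNIV[symmetric] sum.Plus del: UNIV_Plus_UNIV)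

lemma power2_norm_vec_sum_type:
  "(norm u)\<^sup>2 = (norm (\<chi> a. u $ Inl a))\<^sup>2 + (norm (\<chi> b. u $ Inr b))\<^sup>2"
  for u :: "real^('a::finite + 'b::finite)"
  by (simp add: power2_norm_eq_inner inner_vec_def sum_UNIV_sum_type)

lemma dilation_mult_vector:
  "dilation A *v u = (\<chi> i. case i of Inl a \<Rightarrow> (A *v (\<chi> b. u $ Inr b)) $ a
    | Inr b \<Rightarrow> (transpose A *v (\<chi> a. u $ Inl a)) $ b)"
  for A :: "real^'n^'m"
  by (auto simp: vec_eq_iff dilation_def matrix_vector_mult_def transpose_def
      sum_UNIV_sum_type mult.commute split: sum.splits)

lemma power2_norm_dilation_mult_vector:
  "(norm (dilation A *v u))\<^sup>2
    = (norm (A *v (\<chi> b. u $ Inr b)))\<^sup>2 + (norm (transpose A *v (\<chi> a. u $ Inl a)))\<^sup>2"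
  for A :: "real^'n^'m"
  by (subst power2_norm_vec_sum_type) (simp add: dilation_mult_vector)

lemma spectral_norm_dilation: "spectral_norm (dilation A) = spectral_norm A"
  for A :: "real^'n^'m"
proof (rule antisym; rule spectral_norm_le)
  fix u :: "real^('m + 'n)"
  have "(norm (dilation A *v u))\<^sup>2
      \<le> (spectral_norm A * norm (\<chi> b. u $ Inr b))\<^sup>2 + (spectral_norm A * norm (\<chi> a. u $ Inl a))\<^sup>2"
    unfolding power2_norm_dilation_mult_vector
    using norm_matrix_vector_mult_le_spectral_norm[of A]
      norm_matrix_vector_mult_le_spectral_norm[of "transpose A"]
    by (intro add_mono power_mono) (simp_all only: spectral_norm_transpose norm_ge_zero)
  also have "\<dots> = (spectral_norm A * norm u)\<^sup>2"
    by (simp add: power2_norm_vec_sum_type[of u] power_mult_distrib algebra_simps)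
  finally show "norm (dilation A *v u) \<le> spectral_norm A * norm u"
    by (rule power2_le_imp_le) (simp add: spectral_norm_nonneg)
next
  fix x :: "real^'n"
  define u :: "real^('m + 'n)" where "u = (\<chi> i. case i of Inl a \<Rightarrow> 0 | Inr b \<Rightarrow> x $ b)"
  have blocks: "(\<chi> b. u $ Inr b) = x" "(\<chi> a. u $ Inl a) = 0"
    by (simp_all add: u_def vec_eq_iff)
  have "norm (A *v x) = norm (dilation A *v u)"
    using power2_norm_dilation_mult_vector[of A u] by (simp add: blocks)
  also have "\<dots> \<le> spectral_norm (dilation A) * norm u"
    by (rule norm_matrix_vector_mult_le_spectral_norm)
  also have "norm u = norm x"
    using power2_norm_vec_sum_type[of u] by (simp add: blocks)
  finally show "norm (A *v x) \<le> spectral_norm (dilation A) * norm x" .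
qed

theorem sample_mean_spectral_norm_tail:
  fixes A :: "nat \<Rightarrow> real^'d2^'d1"
  assumes "\<And>i. i < N \<Longrightarrow> spectral_norm (A i) \<le> \<sigma>"
    and "0 < \<sigma>" and "1 \<le> n" and "n < N" and "0 \<le> \<epsilon>"
  defines "v \<equiv> 4 * \<sigma>\<^sup>2 * (\<Sum>j = n..<N. 1 / (real j)\<^sup>2)"
  shows "measure_pmf.prob (unif_perm N)
      {\<pi>. \<epsilon> \<le> spectral_norm (sample_mean A n \<pi> - sample_mean A N id)}
    \<le> 2 * real (CARD('d1) + CARD('d2)) * exp (- \<epsilon>\<^sup>2 / (2 * v))"
proof -
  have "trace_subgaussian (unif_perm N)
      (\<lambda>\<pi>. dilation (sample_mean A n \<pi> - sample_mean A N id)) v"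
    unfolding v_def linear_diff[OF linear_dilation] linear_sample_mean[OF linear_dilation]
    using assms(1,3,4)
    by (intro trace_subgaussian_sample_mean)
      (simp_all add: transpose_dilation spectral_norm_dilation)
  moreover have "0 < v"
    unfolding v_def using assms(2-4) by (intro mult_pos_pos sum_pos) auto
  ultimately show ?thesis
    using trace_subgaussian_tail[OF finite_set_pmf_unif_perm _ _ \<open>0 \<le> \<epsilon>\<close>]
    by (fastforce simp: spectral_norm_dilation)
qed

theorem theorem4:
  fixes A :: "nat \<Rightarrow> real^'d2^'d1"
    and N n :: nat and \<sigma> \<epsilon> :: real
  assumes "\<sigma> > 0"
    and "\<forall>i<N. spectral_norm (A i) \<le> \<sigma>"
    and "1 \<le> n" and "n < N"
    and "\<epsilon> > 0"
  defines "\<mu> \<equiv> (1 / real N) *\<^sub>R (\<Sum>i<N. A i)"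
  shows "measure_pmf.prob (unif_perm N)
           {\<pi>. spectral_norm ((1 / real n) *\<^sub>R (\<Sum>i<n. A (\<pi> i)) - \<mu>) \<ge> \<epsilon>}
         \<le> 2 * real (CARD('d1) + CARD('d2)) *
            exp (- (real n * \<epsilon>^2) /
                 (8 * \<sigma>^2 * (1 + 1 / real n) * (1 - real n / real N)))"
proof -
  define v where "v = 4 * \<sigma>\<^sup>2 * (\<Sum>j = n..<N. 1 / (real j)\<^sup>2)"
  define D where "D = 8 * \<sigma>\<^sup>2 * (1 + 1 / real n) * (1 - real n / real N)"
  have "0 < v"
    unfolding v_def using assms(1,3,4) by (intro mult_pos_pos sum_pos) auto
  have "2 * v = 8 * \<sigma>\<^sup>2 * (\<Sum>j = n..<N. 1 / (real j)\<^sup>2)"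
    by (simp add: v_def)
  also have "\<dots> \<le> 8 * \<sigma>\<^sup>2 * ((1 + 1 / real n) * (1 - real n / real N) / real n)"
    using assms(3,4) by (intro mult_left_mono sum_inverse_squares_le) auto
  also have "\<dots> = D / real n"
    by (simp add: D_def)
  finally have "\<epsilon>\<^sup>2 / (D / real n) \<le> \<epsilon>\<^sup>2 / (2 * v)"
    using \<open>0 < v\<close> by (intro frac_le) auto
  then have "exp (- \<epsilon>\<^sup>2 / (2 * v)) \<le> exp (- (real n * \<epsilon>\<^sup>2) / D)"
    by (simp add: mult.commute)
  moreover have "measure_pmf.prob (unif_perm N)
      {\<pi>. spectral_norm ((1 / real n) *\<^sub>R (\<Sum>i<n. A (\<pi> i)) - \<mu>) \<ge> \<epsilon>}
    \<le> 2 * real (CARD('d1) + CARD('d2)) * exp (- \<epsilon>\<^sup>2 / (2 * v))"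
    using sample_mean_spectral_norm_tail[of N A \<sigma> n \<epsilon>] assms(1-5)
    unfolding sample_mean_def v_def \<mu>_def by simp
  ultimately show ?thesis
    unfolding D_def by (elim order_trans) (intro mult_left_mono, simp_all)
qed

end
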